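(* Let $\mathcal{X}$ be a data space equipped with a reference measure $\mathrm{d}\mathbf{x}$, and let $\mathcal{P}$ be the set of probability densities on $\mathcal{X}$ with respect to $\mathrm{d}\mathbf{x}$. Let $r \in \mathbb{R}\cup\{-\infty,+\infty\}$ with $r \notin [0,1]$. Then there exist two positive densities $p^{(1)}, p^{(2)} \in \mathcal{P}$ with $p^{(1)}\neq p^{(2)}$ and a point $\mathbf{x}\in\mathcal{X}$ such that $$\log \overset{\circ}{p}_{2,r}(\mathbf{x}) \;<\; \frac12\sum_{i=1}^2 \log p^{(i)}(\mathbf{x}),$$ where $\overset{\circ}{p}_{2,r}$ is the normalized generalized mean of order $r$ of $p^{(1)},p^{(2)}$.
   Context: $\mathcal{P}$ is the set of functions $p:\mathcal{X}\to\mathbb{R}_{\ge 0}$ with $\int_{\mathcal{X}} p(\mathbf{x})\,\mathrm{d}\mathbf{x}=1$. For positive reals $a_1,\dots,a_k$, the generalized (power) mean of order $r$ is $M_r(a_1,\dots,a_k)=\left(\frac1k\sum_{i=1}^k a_i^r\right)^{1/r}$ for $r\in\mathbb{R}\setminus\{0\}$, $M_0(a_1,\dots,a_k)=\left(\prod_{i=1}^k a_i\right)^{1/k}$, $M_{-\infty}(a_1,\dots,a_k)=\min_i a_i$, and $M_{+\infty}(a_1,\dots,a_k)=\max_i a_i$. For densities $p^{(1)},\dots,p^{(k)}\in\mathcal{P}$ define pointwise $M_{k,r}(\mathbf{x})=M_r\big(p^{(1)}(\mathbf{x}),\dots,p^{(k)}(\mathbf{x})\big)$, the normalization constant $Z_{k,r}=\int_{\mathcal{X}}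 M_{k,r}(\mathbf{x})\,\mathrm{d}\mathbf{x}$, and the normalized generalized mean of order $r$ $$\overset{\circ}{p}_{k,r}(\mathbf{x})=\frac{M_{k,r}(\mathbf{x})}{Z_{k,r}}.$$
   Formalization: The reference measure is additionally assumed sigma-finite (otherwise no positive density exists) and nontrivial: some measurable set and its complement both have positive measure (the claim fails, for example, on a one-point space). *)

theory Defs
  imports "HOL-Analysis.Analysis"
begin

definition prob_densities :: "'a measure \<Rightarrow> ('a \<Rightarrow> real) set" where
  "prob_densities M = {p. (\<forall>x\<in>space M. 0 \<le> p x) \<and> has_bochner_integral M p 1}"

text \<open>The mean of order \<open>r\<close> of positive reals \<open>a 1, \<dots>, a k\<close>, for \<open>k \<ge> 1\<close>.\<close>

definition gen_mean :: "nat \<Rightarrow> ereal \<Rightarrow> (nat \<Rightarrow> real) \<Rightarrow> real" where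
  "gen_mean k r a =
    (case r of
       ereal s \<Rightarrow>
         (if s = 0 then (\<Prod>i=1..k. a i) powr (1 / real k)
          else (1 / real k * (\<Sum>i=1..k. a i powr s)) powr (1 / s))
     | PInfty \<Rightarrow> Max (a ` {1..k})
     | MInfty \<Rightarrow> Min (a ` {1..k}))"

definition mean_fun :: "nat \<Rightarrow> ereal \<Rightarrow> (nat \<Rightarrow> 'a \<Rightarrow> real) \<Rightarrow> 'a \<Rightarrow> real" where
  "mean_fun k r p x = gen_mean k r (\<lambda>i. p i x)"

definition mean_const :: "'a measure \<Rightarrow> nat \<Rightarrow> ereal \<Rightarrow> (nat \<Rightarrow> 'a \<Rightarrow> real) \<Rightarrow> real" where
  "mean_const M k r p = (\<integral>x. mean_fun k r p x \<partial>M)"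

text \<open>For densities the pointwise mean lies between \<open>0\<close> and \<open>p 1 + \<dots> + p k\<close>, so the
  Bochner integral above is a genuine finite value and never the default for
  non-integrable functions.\<close>

definition normalized_mean :: "'a measure \<Rightarrow> nat \<Rightarrow> ereal \<Rightarrow> (nat \<Rightarrow> 'a \<Rightarrow> real) \<Rightarrow> 'a \<Rightarrow> real" where
  "normalized_mean M k r p x = mean_fun k r p x / mean_const M k r p"

end

theory Submission
  imports Defs
begin

text \<open>Split the space into \<open>A\<close> and its complement and fix a positive function \<open>q\<close> with mass one
  on each part. The densities \<open>p\<^sub>1, p\<^sub>2\<close> equal \<open>q\<close> times \<open>s, t\<close> on \<open>A\<close> and \<open>q\<close> times
  \<open>1 - s, 1 - t\<close> off \<open>A\<close>. As power means are homogeneous, \<open>Z = M\<^sub>r(s, t) + M\<^sub>r(1 - s, 1 - t)\<close>,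
  and off \<open>A\<close> the claim becomes
  \<open>M\<^sub>r(1 - s, 1 - t) < Z \<cdot> sqrt ((1 - s) (1 - t))\<close>.
  For \<open>r < 0\<close> let \<open>1 - s\<close> tend to \<open>0\<close> with \<open>t = 1 / 2\<close>: the left side is of order
  \<open>1 - s\<close>, the right side of order \<open>sqrt (1 - s)\<close>. For finite \<open>r > 1\<close> put \<open>s = \<epsilon> u\<close> and
  \<open>t = \<epsilon>\<close>: the right side divided by the left side is \<open>1 + \<epsilon> (M\<^sub>r(u, 1) - (u + 1) / 2) + o(\<epsilon>)\<close>.
  The choice \<open>u = 2 (1 / 2) powr (1 / r) - 1\<close> makes the linear coefficient positive, since
  \<open>M\<^sub>r(u, 1) > (1 / 2) powr (1 / r) = (u + 1) / 2\<close>.\<close>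

section \<open>Power means of two numbers\<close>

text \<open>The test \<open>i = 1\<close> also selects the two densities in the theorem, which lets
  their pointwise mean be read as a \<open>pair_mean\<close>.\<close>

definition pair_mean :: "ereal \<Rightarrow> real \<Rightarrow> real \<Rightarrow> real" where
  "pair_mean r a b = gen_mean 2 r (\<lambda>i. if i = 1 then a else b)"

lemma atLeastAtMost_Suc_0_2: "{Suc 0..2} = {Suc 0, 2}"
  by auto

lemma pair_mean_ereal:
  "s \<noteq> 0 \<Longrightarrow> pair_mean (ereal s) a b = ((a powr s + b powr s) / 2) powr (1 / s)"
  by (simp add: pair_mean_def gen_mean_def atLeastAtMost_Suc_0_2)

lemma pair_mean_0:
  "pair_mean 0 a b = (a * b) powr (1 / 2)"
  unfolding pair_mean_def gen_mean_def zero_ereal_def by (simp add: atLeastAtMost_Suc_0_2)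

lemma pair_mean_PInf: "pair_mean \<infinity> a b = max a b"
  by (simp add: pair_mean_def gen_mean_def atLeastAtMost_Suc_0_2)

lemma pair_mean_MInf: "pair_mean (- \<infinity>) a b = min a b"
  by (simp add: pair_mean_def gen_mean_def atLeastAtMost_Suc_0_2)

lemma pair_mean_pos:
  assumes "0 < a" "0 < b"
  shows "0 < pair_mean r a b"
proof (cases r)
  case (real s)
  have "0 < a powr s + b powr s" using assms by (simp add: add_pos_pos)
  then show ?thesis
    using assms real pair_mean_ereal[of s a b] pair_mean_0[of a b]
    by (cases "s = 0") (auto simp: zero_ereal_def[symmetric])
qed (use assms in \<open>auto simp: pair_mean_PInf pair_mean_MInf\<close>)

lemma pair_mean_scale:
  assumes "0 < c" "0 < a" "0 < b"
  shows "pair_mean r (c * a) (c * b) = c * pair_mean r a b"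
proof (cases r)
  case (real s)
  show ?thesis
  proof (cases "s = 0")
    case True
    have "(c * a * (c * b)) powr (1 / 2) = (c * c * (a * b)) powr (1 / 2)"
      by (simp add: mult_ac)
    also have "\<dots> = c * (a * b) powr (1 / 2)"
      using assms by (simp add: powr_mult powr_half_sqrt)
    finally show ?thesis using real True pair_mean_0 by (simp add: zero_ereal_def[symmetric])
  next
    case False
    have "((c * a) powr s + (c * b) powr s) / 2 = c powr s * ((a powr s + b powr s) / 2)"
      using assms by (simp add: powr_mult algebra_simps)
    then have "(((c * a) powr s + (c * b) powr s) / 2) powr (1 / s)
        = c * ((a powr s + b powr s) / 2) powr (1 / s)"
      using assms False by (simp only: powr_mult) (simp add: powr_powr)
    then show ?thesis
      using False real by (simp only: pair_mean_ereal[OF False])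
  qed
next
  case PInf
  then show ?thesis using assms by (simp add: pair_mean_PInf max_mult_distrib_left)
next
  case MInf
  then show ?thesis using assms by (simp add: pair_mean_MInf min_mult_distrib_left)
qed

lemma pair_mean_ge_min:
  assumes "0 < a" "a \<le> b" "s < 0"
  shows "a \<le> pair_mean (ereal s) a b"
proof -
  have "(a powr s + b powr s) / 2 \<le> a powr s"
    using powr_mono2'[of s a b] assms by simp
  moreover have "0 < (a powr s + b powr s) / 2" using assms by (simp add: add_pos_pos)
  ultimately have "(a powr s) powr (1 / s) \<le> ((a powr s + b powr s) / 2) powr (1 / s)"
    using assms by (intro powr_mono2') auto
  then show ?thesis using assms by (simp add: pair_mean_ereal powr_powr)
qed

text \<open>Dropping \<open>b powr s\<close> shrinks the base, and the negative exponent
  \<open>1 / s\<close> turns this into an upper bound that is uniform in \<open>b\<close>.\<close>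

lemma pair_mean_le_neg:
  assumes "0 < a" "0 < b" "s < 0"
  shows "pair_mean (ereal s) a b \<le> (1 / 2) powr (1 / s) * a"
proof -
  have "((a powr s + b powr s) / 2) powr (1 / s) \<le> (1 / 2 * a powr s) powr (1 / s)"
    using assms by (intro powr_mono2') auto
  also have "\<dots> = (1 / 2) powr (1 / s) * a"
    using assms by (simp only: powr_mult powr_powr) (simp add: powr_powr)
  finally show ?thesis using assms by (simp add: pair_mean_ereal)
qed

text \<open>Dropping the positive term \<open>a powr s\<close> strictly lowers the mean. With
  \<open>a = u\<close> and \<open>b = 1\<close> this makes the linear coefficient positive.\<close>

lemma pair_mean_gt_pos:
  assumes "0 < a" "0 < b" "0 < s"
  shows "(1 / 2) powr (1 / s) * b < pair_mean (ereal s) a b"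
proof -
  have "(1 / 2) powr (1 / s) * b = (1 / 2 * b powr s) powr (1 / s)"
    using assms by (simp only: powr_mult powr_powr) (simp add: powr_powr)
  also have "\<dots> < ((a powr s + b powr s) / 2) powr (1 / s)"
    using assms by (intro powr_less_mono2) auto
  finally show ?thesis using assms by (simp add: pair_mean_ereal)
qed

section \<open>The two-point inequality for orders outside [0, 1]\<close>

lemma two_point_defect_neg:
  assumes "r < 0"
  obtains s t where "0 < s" "s < 1" "0 < t" "t < 1" "s \<noteq> t"
    "pair_mean r (1 - s) (1 - t)
      < (pair_mean r s t + pair_mean r (1 - s) (1 - t)) * sqrt ((1 - s) * (1 - t))"
proof -
  \<comment> \<open>These bounds let finite negative orders and minus infinity be treated alike;
    \<open>C\<close> depends on \<open>r\<close> but not on \<open>a\<close> and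
    \<open>b\<close>.\<close>
  obtain C where C: "1 \<le> C" and upper: "\<And>a b. 0 < a \<Longrightarrow> 0 < b \<Longrightarrow> pair_mean r a b \<le> C * a"
    and lower: "\<And>a b. 0 < a \<Longrightarrow> a \<le> b \<Longrightarrow> a \<le> pair_mean r b a"
  proof (cases r)
    case (real s)
    then have "s < 0" using assms by simp
    have "1 \<le> (1 / 2) powr (1 / s)"
      using \<open>s < 0\<close> powr_mono2'[of "1 / s" "1 / 2" 1] by simp
    moreover have "pair_mean r b a = pair_mean r a b" for a b
      using \<open>s < 0\<close> real by (simp add: pair_mean_ereal add.commute)
    ultimately show thesis
      using \<open>s < 0\<close> real
      by (intro that[of "(1 / 2) powr (1 / s)"]) (simp_all add: pair_mean_le_neg pair_mean_ge_min)
  next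
    case MInf
    then show thesis using that[of 1] by (simp add: pair_mean_MInf)
  qed (use assms in auto)
  \<comment> \<open>\<open>e\<close> is the small value of \<open>1 - s\<close>. The left side is at
    most \<open>C * e = 1 / (16 * C)\<close>; on the right the root exceeds
    \<open>1 / (8 * C)\<close> and the sum of means is at least \<open>1 / 2\<close>.\<close>
  define e where "e = 1 / (16 * C\<^sup>2)"
  have C2: "1 \<le> C\<^sup>2" using C by simp
  then have e: "0 < e" "e \<le> 1 / 16" by (auto simp: e_def divide_simps)
  have Ce: "C * e = 1 / (16 * C)" using C by (simp add: e_def power2_eq_square)
  have "1 / (32 * C\<^sup>2) > (1 / (8 * C))\<^sup>2"
    using C by (simp add: power2_eq_square divide_simps)
  then have root: "1 / (8 * C) < sqrt (e * (1 / 2))"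
    using C by (intro real_less_rsqrt) (simp add: e_def)
  have "pair_mean r e (1 / 2) \<le> 1 / (16 * C)" using upper[of e "1 / 2"] e Ce by simp
  also have "\<dots> = 1 / 2 * (1 / (8 * C))" by simp
  also have "\<dots> < 1 / 2 * sqrt (e * (1 / 2))" using root by simp
  also have "\<dots> \<le> (pair_mean r (1 - e) (1 / 2) + pair_mean r e (1 / 2)) * sqrt (e * (1 / 2))"
    using lower[of "1 / 2" "1 - e"] pair_mean_pos[of e "1 / 2" r] e
    by (intro mult_right_mono) auto
  finally show thesis using that[of "1 - e" "1 / 2"] e by simp
qed

lemma two_point_defect_gt_1:
  assumes "1 < \<rho>"
  obtains s t where "0 < s" "s < 1" "0 < t" "t < 1" "s \<noteq> t"
    "pair_mean (ereal \<rho>) (1 - s) (1 - t)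
      < (pair_mean (ereal \<rho>) s t + pair_mean (ereal \<rho>) (1 - s) (1 - t)) * sqrt ((1 - s) * (1 - t))"
proof -
  let ?m = "pair_mean (ereal \<rho>)"
  define u where "u = 2 * (1 / 2) powr (1 / \<rho>) - 1"
  have "(1 / 2) powr 1 < (1 / 2 :: real) powr (1 / \<rho>)" "(1 / 2 :: real) powr (1 / \<rho>) < (1 / 2) powr 0"
    using assms by (intro powr_less_mono'; simp)+
  then have u: "0 < u" "u < 1" by (auto simp: u_def)
  define c where "c = ?m u 1"
  have c: "(u + 1) / 2 < c"
    using pair_mean_gt_pos[of u 1 \<rho>] u assms by (simp add: c_def u_def)
  \<comment> \<open>Spelling the mean out with \<open>powr\<close> lets the derivative rules apply
    at 0, where both inner bases equal 1.\<close>
  define m where "m \<epsilon> = (((1 - \<epsilon> * u) powr \<rho> + (1 - \<epsilon>) powr \<rho>) / 2) powr (1 / \<rho>)" for \<epsilon> :: real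
  have m_eq: "m \<epsilon> = ?m (1 - \<epsilon> * u) (1 - \<epsilon>)" for \<epsilon>
    using assms by (simp add: m_def pair_mean_ereal)
  have dm: "(m has_real_derivative - ((u + 1) / 2)) (at 0)"
    unfolding m_def using assms
    by (auto intro!: derivative_eq_intros simp: field_simps)
  have "m 0 = 1" by (simp add: m_def)
  \<comment> \<open>\<open>F\<close> is the logarithm of the left side over the right side and
    vanishes at 0. There the derivatives of the first two terms cancel, leaving that of the
    last.\<close>
  define F where "F \<epsilon> = ln (m \<epsilon>) - (ln (1 - \<epsilon> * u) + ln (1 - \<epsilon>)) / 2 - ln (\<epsilon> * c + m \<epsilon>)" for \<epsilon> :: real
  have "(F has_real_derivative - (c - (u + 1) / 2)) (at 0)"
    unfolding F_def using \<open>m 0 = 1\<close>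
    by (auto intro!: derivative_eq_intros dm simp: field_simps)
  from DERIV_neg_dec_right[OF this] obtain d where d: "0 < d"
    and F_less: "\<And>h. 0 < h \<Longrightarrow> h < d \<Longrightarrow> F h < F 0" using c by auto
  \<comment> \<open>The cap \<open>1 / 2\<close> keeps both parameters inside (0, 1), so every
    logarithm in \<open>F\<close> has a positive argument.\<close>
  define \<epsilon> where "\<epsilon> = min (d / 2) (1 / 2)"
  have e: "0 < \<epsilon>" "\<epsilon> < d" "\<epsilon> < 1" using d by (auto simp: \<epsilon>_def)
  have eu: "0 < \<epsilon> * u" "\<epsilon> * u < \<epsilon>" using e u by auto
  have mp: "0 < m \<epsilon>" unfolding m_eq using e eu by (intro pair_mean_pos) auto
  have cp: "0 < c" using c u by simp
  have Zp: "0 < \<epsilon> * c + m \<epsilon>" using e mp cp by (simp add: add_pos_pos)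
  have "F \<epsilon> < 0" using F_less[OF e(1,2)] \<open>m 0 = 1\<close> by (simp add: F_def)
  then have "ln (m \<epsilon>) < ln ((\<epsilon> * c + m \<epsilon>) * sqrt ((1 - \<epsilon> * u) * (1 - \<epsilon>)))"
    using e eu Zp by (simp add: F_def ln_mult ln_sqrt)
  then have "m \<epsilon> < (\<epsilon> * c + m \<epsilon>) * sqrt ((1 - \<epsilon> * u) * (1 - \<epsilon>))"
    using e eu mp Zp by (subst (asm) ln_less_cancel_iff) (auto intro!: mult_pos_pos)
  moreover have scale: "\<epsilon> * c = ?m (\<epsilon> * u) \<epsilon>"
    using pair_mean_scale[of \<epsilon> u 1 "ereal \<rho>"] e u by (simp add: c_def)
  ultimately have defect: "?m (1 - \<epsilon> * u) (1 - \<epsilon>)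
      < (?m (\<epsilon> * u) \<epsilon> + ?m (1 - \<epsilon> * u) (1 - \<epsilon>)) * sqrt ((1 - \<epsilon> * u) * (1 - \<epsilon>))"
    by (simp only: m_eq)
  have eu': "\<epsilon> * u \<noteq> \<epsilon>" "\<epsilon> * u < 1" using eu e by linarith+
  show thesis by (rule that[OF eu(1) eu'(2) e(1,3) eu'(1) defect])
qed

lemma two_point_defect:
  assumes "r \<notin> {0..1::ereal}"
  obtains s t where "0 < s" "s < 1" "0 < t" "t < 1" "s \<noteq> t"
    "pair_mean r (1 - s) (1 - t)
      < (pair_mean r s t + pair_mean r (1 - s) (1 - t)) * sqrt ((1 - s) * (1 - t))"
proof (cases "r < 0")
  case True
  then show thesis using two_point_defect_neg that by blast
next
  case False
  then have "1 < r" using assms by auto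
  show thesis
  proof (cases r)
    case (real \<rho>)
    then show thesis using two_point_defect_gt_1[of \<rho>] that \<open>1 < r\<close> by auto
  next
    case PInf
    \<comment> \<open>For \<open>s = 1 / 4\<close> and \<open>t = 1 / 2\<close> the two maxima are
      \<open>1 / 2\<close> and \<open>3 / 4\<close>, so the claim is
      \<open>3 / 4 < 5 / 4 * sqrt (3 / 8)\<close>.\<close>
    have "3 / 5 < sqrt (3 / 8)" by (intro real_less_rsqrt) (simp add: power2_eq_square)
    then show thesis using that[of "1 / 4" "1 / 2"] PInf by (simp add: pair_mean_PInf)
  qed (use \<open>1 < r\<close> in auto)
qed

section \<open>Densities on a space split in two\<close>

text \<open>Sigma-finiteness yields a strictly positive integrable function even if the parts have
  infinite measure; dividing it on each part by its integral there makes both masses one.\<close>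

lemma (in sigma_finite_measure) ex_positive_unit_mass_on_parts:
  assumes A: "A \<in> sets M" and pos: "0 < emeasure M A" "0 < emeasure M (space M - A)"
  obtains q :: "'a \<Rightarrow> real" where "\<forall>x\<in>space M. 0 < q x"
    "\<forall>a b. has_bochner_integral M (\<lambda>x. q x * (if x \<in> A then a else b)) (a + b)"
proof -
  obtain h where h: "h \<in> borel_measurable M" "integral\<^sup>N M h \<noteq> \<infinity>"
    and h_pos: "\<And>x. x \<in> space M \<Longrightarrow> 0 < h x \<and> h x < \<infinity>"
    using Ex_finite_integrable_function by blast
  define f where "f x = enn2real (h x)" for x
  have f_pos: "0 < f x" if "x \<in> space M" for x
    using h_pos[OF that] by (simp add: f_def enn2real_positive_iff)
  have f_meas[measurable]: "f \<in> borel_measurable M" unfolding f_def using h by measurable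
  have "(\<integral>\<^sup>+x. ennreal (f x) \<partial>M) = integral\<^sup>N M h"
    using h_pos by (intro nn_integral_cong) (auto simp: f_def)
  then have int_f: "integrable M f"
    using h f_pos by (intro integrableI_nonneg) (auto simp: less_top less_imp_le)
  have part: "0 < (\<integral>x. f x * indicator B x \<partial>M)" "integrable M (\<lambda>x. f x * indicator B x)"
    if B: "B \<in> sets M" "0 < emeasure M B" for B
  proof -
    show int: "integrable M (\<lambda>x. f x * indicator B x)"
      using int_f B by (intro integrable_real_mult_indicator)
    \<comment> \<open>A nonnegative function with zero integral vanishes almost everywhere; as
      \<open>f\<close> is positive, \<open>B\<close> would be null.\<close>
    have "(\<integral>x. f x * indicator B x \<partial>M) \<noteq> 0"
    proof
      assume "(\<integral>x. f x * indicator B x \<partial>M) = 0"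
      then have "AE x in M. f x * indicator B x = 0"
        using int f_pos by (subst (asm) integral_nonneg_eq_0_iff_AE) (auto simp: less_imp_le)
      then have "AE x in M. x \<notin> B"
        using AE_space by eventually_elim (use f_pos in \<open>force simp: indicator_def split: if_splits\<close>)
      then have "emeasure M B = 0"
        using B sets.sets_into_space[of B M] by (subst (asm) AE_iff_measurable[of B]) auto
      then show False using B by simp
    qed
    moreover have "0 \<le> (\<integral>x. f x * indicator B x \<partial>M)"
      using f_pos by (intro integral_nonneg_AE) (auto simp: less_imp_le)
    ultimately show "0 < (\<integral>x. f x * indicator B x \<partial>M)" by simp
  qed
  define I where "I B = (\<integral>x. f x * indicator B x \<partial>M)" for B
  define q where "q x = f x / (if x \<in> A then I A else I (space M - A))" for x
  have I_pos: "0 < I A" "0 < I (space M - A)" using part A pos by (auto simp: I_def)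
  show thesis
  proof (intro that ballI allI)
    show "0 < q x" if "x \<in> space M" for x
      using that I_pos f_pos by (simp add: q_def)
  next
    fix a b
    have "has_bochner_integral M (\<lambda>x. (a / I A) * (f x * indicator A x)
        + (b / I (space M - A)) * (f x * indicator (space M - A) x))
        ((a / I A) * I A + (b / I (space M - A)) * I (space M - A))"
      unfolding I_def using part A pos
      by (intro has_bochner_integral_add has_bochner_integral_mult_right has_bochner_integral_integrable) auto
    moreover have "(a / I A) * I A + (b / I (space M - A)) * I (space M - A) = a + b"
      using I_pos by simp
    ultimately show "has_bochner_integral M (\<lambda>x. q x * (if x \<in> A then a else b)) (a + b)"
      by (subst has_bochner_integral_cong[OF refl _ refl]) (auto simp: q_def)
  qed
qed

text \<open>Strictly positive integrable functions exist only on sigma-finite spaces, and a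
  one-point space carries at most one density; the first two hypotheses exclude these
  obstructions.\<close>

theorem theorem3p2:
  fixes M :: "'a measure" and r :: ereal
  assumes "sigma_finite_measure M"
    and "\<exists>A\<in>sets M. 0 < emeasure M A \<and> 0 < emeasure M (space M - A)"
    and "r \<notin> {0..1}"
  shows "\<exists>p :: nat \<Rightarrow> 'a \<Rightarrow> real.
    (\<forall>i\<in>{1, 2}. p i \<in> prob_densities M \<and> (\<forall>x\<in>space M. 0 < p i x)) \<and>
    (\<exists>y\<in>space M. p 1 y \<noteq> p 2 y) \<and>
    (\<exists>x\<in>space M. ln (normalized_mean M 2 r p x) < 1 / 2 * (\<Sum>i=1..2. ln (p i x)))"
proof -
  interpret sigma_finite_measure M by fact
  obtain A where A: "A \<in> sets M" "0 < emeasure M A" "0 < emeasure M (space M - A)"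
    using assms(2) by blast
  obtain q :: "'a \<Rightarrow> real" where q_pos': "\<forall>x\<in>space M. 0 < q x"
    and q_int': "\<forall>a b. has_bochner_integral M (\<lambda>x. q x * (if x \<in> A then a else b)) (a + b)"
    by (rule ex_positive_unit_mass_on_parts[OF A])
  note q_pos = bspec[OF q_pos'] and q_int = q_int'[rule_format]
  obtain s t where st: "0 < s" "s < 1" "0 < t" "t < 1" "s \<noteq> t"
    and defect: "pair_mean r (1 - s) (1 - t)
      < (pair_mean r s t + pair_mean r (1 - s) (1 - t)) * sqrt ((1 - s) * (1 - t))"
    by (rule two_point_defect[OF assms(3)])
  \<comment> \<open>Any point off \<open>A\<close> serves, since the factor \<open>q x\<close> is
    common to both sides of the inequality.\<close>
  have "space M - A \<noteq> {}" using A(3) by (metis emeasure_empty less_irrefl)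
  then obtain x where x: "x \<in> space M" "x \<notin> A" by blast
  define p where "p i x = q x * (if x \<in> A then if i = 1 then s else t else if i = 1 then 1 - s else 1 - t)"
    for i :: nat and x
  have p_pos: "0 < p i y" if "y \<in> space M" for i y
    using q_pos[OF that] st by (auto simp: p_def)
  have p_dens: "p i \<in> prob_densities M" for i
  proof -
    have "has_bochner_integral M (p i) 1"
      using q_int[of s "1 - s"] q_int[of t "1 - t"] unfolding p_def by (cases "i = 1") simp_all
    then show ?thesis using p_pos by (simp add: prob_densities_def less_imp_le)
  qed
  define m where "m = pair_mean r s t"
  define m' where "m' = pair_mean r (1 - s) (1 - t)"
  have mean: "mean_fun 2 r p y = q y * (if y \<in> A then m else m')" if "y \<in> space M" for y
  proof -
    have "(\<lambda>i. p i y) = (\<lambda>i. if i = 1 then q y * (if y \<in> A then s else 1 - s)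
        else q y * (if y \<in> A then t else 1 - t))"
      by (auto simp: p_def)
    then show ?thesis
      using pair_mean_scale[OF q_pos[OF that]] st by (simp add: mean_fun_def pair_mean_def m_def m'_def)
  qed
  have "mean_const M 2 r p = (\<integral>y. q y * (if y \<in> A then m else m') \<partial>M)"
    unfolding mean_const_def by (rule Bochner_Integration.integral_cong) (simp_all add: mean)
  also have "\<dots> = m + m'" using q_int by (rule has_bochner_integral_integral_eq)
  finally have Z: "mean_const M 2 r p = m + m'" .
  have m_pos: "0 < m" "0 < m'" using st by (auto simp: m_def m'_def intro!: pair_mean_pos)
  have "normalized_mean M 2 r p x = q x * (m' / (m + m'))"
    using mean[OF x(1)] x Z by (simp add: normalized_mean_def)
  also have "ln \<dots> < ln (q x * sqrt ((1 - s) * (1 - t)))"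
  proof (subst ln_less_cancel_iff)
    have "m' / (m + m') < sqrt ((1 - s) * (1 - t))"
      using defect m_pos by (simp add: m_def m'_def pos_divide_less_eq mult.commute)
    then show "q x * (m' / (m + m')) < q x * sqrt ((1 - s) * (1 - t))"
      using q_pos[OF x(1)] by (rule mult_strict_left_mono)
  qed (use q_pos[of x] x m_pos st in \<open>auto intro!: mult_pos_pos divide_pos_pos add_pos_pos\<close>)
  also have "\<dots> = 1 / 2 * (\<Sum>i=1..2. ln (p i x))"
    using x q_pos[of x] st by (simp add: p_def atLeastAtMost_Suc_0_2 ln_mult ln_sqrt add_divide_distrib)
  finally have "ln (normalized_mean M 2 r p x) < 1 / 2 * (\<Sum>i=1..2. ln (p i x))" .
  moreover have "p 1 x \<noteq> p 2 x" using x q_pos[of x] st by (simp add: p_def)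
  ultimately show ?thesis using p_pos p_dens x by blast
qed

end
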